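(* Let $L=(T,V,E)$ be a link stream and let $\Delta$ be a duration. Then Algorithm 1 (described in the context), run on input $(L,\Delta)$, computes the set of all maximal $\Delta$-cliques of $L$; that is, the set $R$ it returns is exactly the set of all maximal $\Delta$-cliques of $L$.
   Context: **Link streams.** A link stream is $L=(T,V,E)$ where $T=[\alpha,\omega]$ is a time interval, $V$ is a finite set of nodes and $E\subseteq T\times V\times V$ is a finite set of links; $(t,u,v)\in E$ means that $u$ and $v$ interact at time $t$. Links are undirected ($(t,u,v)$ and $(t,v,u)$ are not distinguished), there are no loops $(t,v,v)$, and no isolated nodes (every $v\in V$ occurs in some link $(t,u,v)\in E$). **$\Delta$-cliques.** For a duration $\Delta$, a $\Delta$-clique of $L$ is a pair $C=(X,[b,e])$ with $X\subseteq V$, $|X|\ge 2$, $[b,e]\subseteq T$, such that for all $\{u,v\}\subseteq X$ (with $u\neq v$) and all $\tau\in[b,\max(e-\Delta,b)]$ there is a link $(t,u,v)\in E$ with $t\in[\tau,\min(\tau+\Delta,e)]$. A $\Delta$-clique $C=(X,[b,e])$ is maximal if there is no $\Delta$-clique $C'=(X',[b',e'])\ne C$ with $X\subseteq X'$ and $[b,e]\subseteq[b',e']$. **Notation.** $f_{buv}$ is the smallest $t\ge b$ with $(t,u,v)\in E$; $l_{euv}$ is the largest $t\le e$ with $(t,u,v)\in E$. **Algorithm 1** (input: $L=(T,V,E)$ and $\Delta$; output: a set $R$). Initialize $S,R,M$ to $\emptyset$. For each $(t,u,v)\in E$, add $(\{u,v\},[t,t])$ to $S$ and to $M$. While $S\neq\emptyset$,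 do the following: 1. Take and remove an element $(X,[b,e])$ from $S$ (in arbitrary order), and set isMax to True. 2. For each $v\in V\setminus X$: if $(X\cup\{v\},[b,e])$ is a $\Delta$-clique, set isMax to False and, if $(X\cup\{v\},[b,e])\notin M$, add it to $S$ and $M$. 3. Let $f=\max_{u,v\in X,\,u\ne v} f_{buv}$ and $b'=f-\Delta$. If $b\neq b'$, set isMax to False and, if $(X,[b',e])\notin M$, add it to $S$ and $M$. 4. Let $l=\min_{u,v\in X,\,u\ne v} l_{euv}$ and $e'=l+\Delta$. If $e\neq e'$, set isMax to False and, if $(X,[b,e'])\notin M$, add it to $S$ and $M$. 5. If isMax is True, add $(X,[b,e])$ to $R$. When $S=\emptyset$, return $R$.
   Formalization: Proved when every link time t satisfies α ≤ t−Δ and t+Δ ≤ ω; otherwise the claim fails, since b'=f−Δ and e'=l+Δ are not cut off at T: with T=[0,10], E={(0,u,v)}, Δ=3 the algorithm returns ({u,v},[−3,3]), which is not inside T. *)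

theory Defs
  imports Complex_Main
begin

record 'v link_stream =
  t_start :: real
  t_stop :: real
  nodes :: "'v set"
  links :: "(real \<times> 'v \<times> 'v) set"

abbreviation time_span :: "'v link_stream \<Rightarrow> real set" where
  "time_span L \<equiv> {t_start L..t_stop L}"

text \<open>Links are undirected: the triples \<open>(t, u, v)\<close> and \<open>(t, v, u)\<close> denote the same link.
  \<open>links L\<close> may contain either one or both, and is only ever queried through \<open>linked\<close>.\<close>

definition linked :: "'v link_stream \<Rightarrow> real \<Rightarrow> 'v \<Rightarrow> 'v \<Rightarrow> bool" where
  "linked L t u v \<longleftrightarrow> (t, u, v) \<in> links L \<or> (t, v, u) \<in> links L"

definition is_link_stream :: "'v link_stream \<Rightarrow> bool" where
  "is_link_stream L \<longleftrightarrow>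
     t_start L \<le> t_stop L \<and>
     finite (nodes L) \<and>
     finite (links L) \<and>
     links L \<subseteq> time_span L \<times> nodes L \<times> nodes L \<and>
     (\<forall>t v. (t, v, v) \<notin> links L) \<and>
     (\<forall>v\<in>nodes L. \<exists>t u. linked L t u v)"

text \<open>The pair \<open>(X, [b, e])\<close> is represented by the triple \<open>(X, b, e)\<close>.\<close>

type_synonym 'v candidate = "'v set \<times> real \<times> real"

definition delta_clique :: "'v link_stream \<Rightarrow> real \<Rightarrow> 'v candidate \<Rightarrow> bool" where
  "delta_clique L \<Delta> = (\<lambda>(X, b, e).
     X \<subseteq> nodes L \<and> 2 \<le> card X \<and> b \<le> e \<and> {b..e} \<subseteq> time_span L \<and>
     (\<forall>u\<in>X. \<forall>v\<in>X. u \<noteq> v \<longrightarrow>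
        (\<forall>\<tau>\<in>{b..max (e - \<Delta>) b}. \<exists>t\<in>{\<tau>..min (\<tau> + \<Delta>) e}. linked L t u v)))"

definition maximal_delta_clique :: "'v link_stream \<Rightarrow> real \<Rightarrow> 'v candidate \<Rightarrow> bool" where
  "maximal_delta_clique L \<Delta> = (\<lambda>(X, b, e).
     delta_clique L \<Delta> (X, b, e) \<and>
     (\<nexists>X' b' e'. delta_clique L \<Delta> (X', b', e') \<and> (X', b', e') \<noteq> (X, b, e) \<and>
        X \<subseteq> X' \<and> {b..e} \<subseteq> {b'..e'}))"

text \<open>The times \<open>f\<^sub>b\<^sub>u\<^sub>v\<close> and \<open>l\<^sub>e\<^sub>u\<^sub>v\<close>. The sets are finite when \<open>L\<close> is a link stream;
  the values are meaningful only if they are also nonempty.\<close>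

definition first_link :: "'v link_stream \<Rightarrow> real \<Rightarrow> 'v \<Rightarrow> 'v \<Rightarrow> real" where
  "first_link L b u v = Min {t. b \<le> t \<and> linked L t u v}"

definition last_link :: "'v link_stream \<Rightarrow> real \<Rightarrow> 'v \<Rightarrow> 'v \<Rightarrow> real" where
  "last_link L e u v = Max {t. t \<le> e \<and> linked L t u v}"

text \<open>The candidates by which a loop iteration may enlarge \<open>C\<close>. The flag isMax stays true
  exactly if there are none. The new end points are not cut off at the ends of the time span:
  with a link closer than \<open>\<Delta>\<close> to either end, the algorithm produces candidates that leave
  the time span and hence are not \<open>\<Delta>\<close>-cliques.\<close>

definition node_extensions :: "'v link_stream \<Rightarrow> real \<Rightarrow> 'v candidate \<Rightarrow> 'v candidate set" where
  "node_extensions L \<Delta> = (\<lambda>(X, b, e).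
     {(X \<union> {v}, b, e) | v. v \<in> nodes L - X \<and> delta_clique L \<Delta> (X \<union> {v}, b, e)})"

definition left_extension :: "'v link_stream \<Rightarrow> real \<Rightarrow> 'v candidate \<Rightarrow> 'v candidate set" where
  "left_extension L \<Delta> = (\<lambda>(X, b, e).
     let f = Max {first_link L b u v | u v. u \<in> X \<and> v \<in> X \<and> u \<noteq> v}; b' = f - \<Delta>
     in if b \<noteq> b' then {(X, b', e)} else {})"

definition right_extension :: "'v link_stream \<Rightarrow> real \<Rightarrow> 'v candidate \<Rightarrow> 'v candidate set" where
  "right_extension L \<Delta> = (\<lambda>(X, b, e).
     let l = Min {last_link L e u v | u v. u \<in> X \<and> v \<in> X \<and> u \<noteq> v}; e' = l + \<Delta>
     in if e \<noteq> e' then {(X, b, e')} else {})"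

text \<open>Adds to both \<open>S\<close> and \<open>M\<close> those elements of \<open>N\<close> that are not yet in \<open>M\<close>.\<close>

definition add_new :: "'a set \<Rightarrow> 'a set \<times> 'a set \<Rightarrow> 'a set \<times> 'a set" where
  "add_new N = (\<lambda>(S, M). (S \<union> (N - M), M \<union> N))"

text \<open>States are triples \<open>(S, R, M)\<close>. A step is one full loop iteration; its only
  nondeterminism is the choice of the element \<open>C\<close> taken from \<open>S\<close>.\<close>

type_synonym 'v alg_state = "'v candidate set \<times> 'v candidate set \<times> 'v candidate set"

definition alg_init :: "'v link_stream \<Rightarrow> 'v alg_state" where
  "alg_init L = (let I = {({u, v}, t, t) | t u v. (t, u, v) \<in> links L} in (I, {}, I))"

inductive alg_step :: "'v link_stream \<Rightarrow> real \<Rightarrow> 'v alg_state \<Rightarrow> 'v alg_state \<Rightarrow> bool"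
  for L :: "'v link_stream" and \<Delta> :: real where
  iteration:
  "C \<in> S \<Longrightarrow>
   N = node_extensions L \<Delta> C \<Longrightarrow>
   F = left_extension L \<Delta> C \<Longrightarrow>
   G = right_extension L \<Delta> C \<Longrightarrow>
   (S', M') = add_new G (add_new F (add_new N (S - {C}, M))) \<Longrightarrow>
   R' = (if N = {} \<and> F = {} \<and> G = {} then R \<union> {C} else R) \<Longrightarrow>
   alg_step L \<Delta> (S, R, M) (S', R', M')"

definition alg_terminates :: "'v link_stream \<Rightarrow> real \<Rightarrow> bool" where
  "alg_terminates L \<Delta> \<longleftrightarrow>
     (\<nexists>\<sigma>. \<sigma> 0 = alg_init L \<and> (\<forall>i::nat. alg_step L \<Delta> (\<sigma> i) (\<sigma> (Suc i))))"

text \<open>Some run of the algorithm returns \<open>R\<close>.\<close>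

definition alg_returns :: "'v link_stream \<Rightarrow> real \<Rightarrow> 'v candidate set \<Rightarrow> bool" where
  "alg_returns L \<Delta> R \<longleftrightarrow> (\<exists>M. (alg_step L \<Delta>)\<^sup>*\<^sup>* (alg_init L) ({}, R, M))"

end

theory Submission
  imports Defs
begin

text \<open>Every candidate ever created is a \<open>\<Delta>\<close>-clique whose end points come from a finite set, and
  every iteration moves one candidate to the set of processed ones; this gives termination. On
  return, the set \<open>M\<close> is closed under extensions, and \<open>R\<close> consists of its non-extendable
  elements. A non-extendable clique is maximal: if \<open>b\<close> is \<open>\<Delta>\<close> before the latest first link, some
  pair has no link in \<open>[b, b + \<Delta>)\<close>, so a clique starting before \<open>b\<close> would force links of this
  pair in \<open>[b - \<epsilon>, b)\<close> for all small \<open>\<epsilon>\<close>; the right end is symmetric.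
  Conversely, let \<open>(X, [b, e])\<close> be maximal, and let \<open>u, v\<close> be a pair whose first link after \<open>b\<close>
  is at time \<open>f = b + \<Delta>\<close>. Then \<open>M\<close> contains successively \<open>({u, v}, [f, f])\<close>,
  \<open>({u, v}, [b, f])\<close>, \<open>(X, [b, f])\<close>, and finally \<open>(X, [b, e])\<close>, since extending to the right
  never passes \<open>e\<close> and never gets stuck before it.\<close>

section \<open>Links, end points of extensions, and gaps in finite sets of times\<close>

lemma linked_sym: "linked L t u v \<longleftrightarrow> linked L t v u"
  by (auto simp: linked_def)

lemma first_link_sym: "first_link L b u v = first_link L b v u"
  by (simp add: first_link_def linked_sym)

definition latest_first :: "'v link_stream \<Rightarrow> 'v set \<Rightarrow> real \<Rightarrow> real" where
  "latest_first L X b = Max {first_link L b u v | u v. u \<in> X \<and> v \<in> X \<and> u \<noteq> v}"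

definition earliest_last :: "'v link_stream \<Rightarrow> 'v set \<Rightarrow> real \<Rightarrow> real" where
  "earliest_last L X e = Min {last_link L e u v | u v. u \<in> X \<and> v \<in> X \<and> u \<noteq> v}"

lemma left_extension_eq:
  "left_extension L \<Delta> (X, b, e) =
     (if b \<noteq> latest_first L X b - \<Delta> then {(X, latest_first L X b - \<Delta>, e)} else {})"
  by (simp add: left_extension_def latest_first_def Let_def)

lemma right_extension_eq:
  "right_extension L \<Delta> (X, b, e) =
     (if e \<noteq> earliest_last L X e + \<Delta> then {(X, b, earliest_last L X e + \<Delta>)} else {})"
  by (simp add: right_extension_def earliest_last_def Let_def)

text \<open>Merging the three kinds of candidates turns the condition that isMax stays true into
  emptiness of a single set.\<close>

definition extensions :: "'v link_stream \<Rightarrow> real \<Rightarrow> 'v candidate \<Rightarrow> 'v candidate set" where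
  "extensions L \<Delta> C = node_extensions L \<Delta> C \<union> left_extension L \<Delta> C \<union> right_extension L \<Delta> C"

lemma two_le_card_distinct:
  assumes "2 \<le> card X"
  shows "\<exists>u v. u \<in> X \<and> v \<in> X \<and> u \<noteq> v"
  using assms by (metis card_2_iff' obtain_subset_with_card_n subsetD)

lemma finite_pair_values:
  assumes "finite X"
  shows "finite {g u v | u v. u \<in> X \<and> v \<in> X \<and> u \<noteq> v}"
proof (rule finite_subset)
  show "{g u v | u v. u \<in> X \<and> v \<in> X \<and> u \<noteq> v} \<subseteq> (\<lambda>(u, v). g u v) ` (X \<times> X)"
    by auto
qed (use assms in auto)

text \<open>Serves to start a window so close below \<open>b\<close> that no link lies between its
  start and \<open>b\<close>; hence \<open>c\<close> strictly exceeds all elements of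
  \<open>A\<close> below \<open>b\<close>.\<close>

lemma finite_gap_below:
  fixes b :: real
  assumes "finite A"
  obtains c where "c < b" "\<And>t. t \<in> A \<Longrightarrow> t < b \<Longrightarrow> t < c"
proof -
  let ?B = "insert (b - 1) {t \<in> A. t < b}"
  have fin: "finite ?B" using assms by simp
  have "Max ?B < b" using fin by (subst Max_less_iff) auto
  then obtain c where c: "Max ?B < c" "c < b" using dense by blast
  have "t < c" if "t \<in> A" "t < b" for t
    using c(1) Max_ge[OF fin, of t] that by auto
  with c(2) that show thesis by blast
qed

lemma finite_gap_above:
  fixes b :: real
  assumes "finite A"
  obtains c where "b < c" "\<And>t. t \<in> A \<Longrightarrow> b < t \<Longrightarrow> c < t"
proof -
  obtain c where "c < - b" "\<And>t. t \<in> uminus ` A \<Longrightarrow> t < - b \<Longrightarrow> t < c"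
    using finite_gap_below[of "uminus ` A" "- b"] assms by auto
  then show thesis using that[of "- c"] by force
qed

section \<open>Elementary properties of \<open>\<Delta>\<close>-cliques and of loop
  iterations\<close>

lemma delta_cliqueD:
  assumes "delta_clique L \<Delta> (X, b, e)" "u \<in> X" "v \<in> X" "u \<noteq> v" "b \<le> \<tau>" "\<tau> \<le> max (e - \<Delta>) b"
  obtains t where "\<tau> \<le> t" "t \<le> \<tau> + \<Delta>" "t \<le> e" "linked L t u v"
proof -
  have "\<tau> \<in> {b..max (e - \<Delta>) b}" using assms by simp
  then have "\<exists>t\<in>{\<tau>..min (\<tau> + \<Delta>) e}. linked L t u v"
    using assms unfolding delta_clique_def by blast
  then show thesis using that by auto
qed

lemma delta_cliqueI:
  assumes "X \<subseteq> nodes L" "2 \<le> card X" "b \<le> e" "t_start L \<le> b" "e \<le> t_stop L"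
    and "\<And>u v \<tau>. u \<in> X \<Longrightarrow> v \<in> X \<Longrightarrow> u \<noteq> v \<Longrightarrow> b \<le> \<tau> \<Longrightarrow> \<tau> \<le> max (e - \<Delta>) b \<Longrightarrow>
      \<exists>t. \<tau> \<le> t \<and> t \<le> \<tau> + \<Delta> \<and> t \<le> e \<and> linked L t u v"
  shows "delta_clique L \<Delta> (X, b, e)"
proof -
  have "\<exists>t\<in>{\<tau>..min (\<tau> + \<Delta>) e}. linked L t u v"
    if "u \<in> X" "v \<in> X" "u \<noteq> v" "\<tau> \<in> {b..max (e - \<Delta>) b}" for u v \<tau>
    using assms(6)[of u v \<tau>] that by auto
  then show ?thesis using assms(1-5) unfolding delta_clique_def by auto
qed

lemma delta_clique_bounds:
  assumes "delta_clique L \<Delta> (X, b, e)"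
  shows "X \<subseteq> nodes L" "2 \<le> card X" "b \<le> e" "t_start L \<le> b" "e \<le> t_stop L"
  using assms unfolding delta_clique_def by auto

text \<open>Shrinking the interval below length \<open>\<Delta>\<close> may destroy a clique, hence \<open>b + \<Delta> \<le> e\<close>.\<close>

lemma delta_clique_restrict:
  assumes C: "delta_clique L \<Delta> (X', b', e')"
    and sub: "X \<subseteq> X'" "2 \<le> card X" "b' \<le> b" "e \<le> e'" and "b + \<Delta> \<le> e" "0 \<le> \<Delta>"
  shows "delta_clique L \<Delta> (X, b, e)"
proof (rule delta_cliqueI)
  fix u v \<tau> assume *: "u \<in> X" "v \<in> X" "u \<noteq> v" "b \<le> \<tau>" "\<tau> \<le> max (e - \<Delta>) b"
  from delta_cliqueD[OF C, of u v \<tau>] * sub assms(6)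
  obtain t where "\<tau> \<le> t" "t \<le> \<tau> + \<Delta>" "linked L t u v" by (smt (verit) subsetD)
  moreover have "t \<le> e" using * assms(6) \<open>t \<le> \<tau> + \<Delta>\<close> by linarith
  ultimately show "\<exists>t. \<tau> \<le> t \<and> t \<le> \<tau> + \<Delta> \<and> t \<le> e \<and> linked L t u v" by blast
qed (use delta_clique_bounds[OF C] assms in auto)

text \<open>The three successive uses of \<open>add_new\<close> collapse into one: whether the sets
  are added singly or together, exactly the elements outside the original \<open>M\<close> enter
  \<open>S\<close>.\<close>

lemma alg_stepE:
  assumes "alg_step L \<Delta> (S, R, M) (S', R', M')"
  obtains C where "C \<in> S"
    "S' = S - {C} \<union> (extensions L \<Delta> C - M)"
    "M' = M \<union> extensions L \<Delta> C"
    "R' = (if extensions L \<Delta> C = {} then R \<union> {C} else R)"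
  using assms
proof cases
  case (iteration C N F G)
  show thesis
    by (rule that[of C]) (use iteration in \<open>auto simp: add_new_def extensions_def\<close>)
qed

lemma alg_step_exists:
  assumes "C \<in> S"
  shows "\<exists>s'. alg_step L \<Delta> (S, R, M) s'"
proof -
  obtain S' M' where "(S', M') = add_new (right_extension L \<Delta> C) (add_new (left_extension L \<Delta> C)
      (add_new (node_extensions L \<Delta> C) (S - {C}, M)))"
    by (metis surj_pair)
  from alg_step.iteration[OF assms refl refl refl this refl] show ?thesis by blast
qed

section \<open>Link times and candidate end points in a padded stream\<close>

locale padded_link_stream =
  fixes L :: "'v link_stream" and \<Delta> :: real
  assumes link_stream: "is_link_stream L"
    and nonneg: "0 \<le> \<Delta>"
    and padded: "\<forall>(t, u, v)\<in>links L. t_start L \<le> t - \<Delta> \<and> t + \<Delta> \<le> t_stop L"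
begin

abbreviation "clique \<equiv> delta_clique L \<Delta>"

definition times :: "real set" where
  "times = fst ` links L"

text \<open>Finite range of all candidates: an initial interval \<open>[t, t]\<close> has link times
  as ends, a left extension puts the left end \<open>\<Delta>\<close> before a link, and a right
  extension puts the right end \<open>\<Delta>\<close> after one.\<close>

definition universe :: "'v candidate set" where
  "universe = Pow (nodes L) \<times> (times \<union> (\<lambda>t. t - \<Delta>) ` times) \<times> (times \<union> (\<lambda>t. t + \<Delta>) ` times)"

lemma finite_nodes: "finite (nodes L)"
  using link_stream by (simp add: is_link_stream_def)

lemma finite_times: "finite times"
  using link_stream by (simp add: is_link_stream_def times_def)

lemma finite_universe: "finite universe"
  unfolding universe_def using finite_nodes finite_times by auto

lemma linked_in_times: "linked L t u v \<Longrightarrow> t \<in> times"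
  by (force simp: linked_def times_def)

lemma finite_linked: "finite {t. P t \<and> linked L t u v}"
  by (rule finite_subset[OF _ finite_times]) (auto intro: linked_in_times)

text \<open>This room of \<open>\<Delta>\<close> around every link keeps extended end points, which
  the algorithm never cuts off, inside the time span.\<close>

lemma times_padded:
  assumes "t \<in> times"
  shows "t_start L \<le> t - \<Delta>" "t + \<Delta> \<le> t_stop L"
proof -
  from assms obtain u v where "(t, u, v) \<in> links L" unfolding times_def by auto
  from bspec[OF padded this] show "t_start L \<le> t - \<Delta>" "t + \<Delta> \<le> t_stop L" by simp_all
qed

lemma clique_finite: "clique (X, b, e) \<Longrightarrow> finite X"
  by (rule finite_subset[OF delta_clique_bounds(1) finite_nodes])

section \<open>First and last links of the pairs in a clique\<close>

lemma first_link_le: "linked L t u v \<Longrightarrow> b \<le> t \<Longrightarrow> first_link L b u v \<le> t"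
  unfolding first_link_def by (rule Min_le[OF finite_linked]) simp

lemma last_link_ge: "linked L t u v \<Longrightarrow> t \<le> e \<Longrightarrow> t \<le> last_link L e u v"
  unfolding last_link_def by (rule Max_ge[OF finite_linked]) simp

lemma first_link_props:
  assumes "linked L t u v" "b \<le> t"
  shows "linked L (first_link L b u v) u v" "b \<le> first_link L b u v"
proof -
  have "first_link L b u v \<in> {t. b \<le> t \<and> linked L t u v}"
    unfolding first_link_def by (rule Min_in[OF finite_linked]) (use assms in auto)
  then show "linked L (first_link L b u v) u v" "b \<le> first_link L b u v" by auto
qed

lemma last_link_props:
  assumes "linked L t u v" "t \<le> e"
  shows "linked L (last_link L e u v) u v" "last_link L e u v \<le> e"
proof -
  have "last_link L e u v \<in> {t. t \<le> e \<and> linked L t u v}"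
    unfolding last_link_def by (rule Max_in[OF finite_linked]) (use assms in auto)
  then show "linked L (last_link L e u v) u v" "last_link L e u v \<le> e" by auto
qed

text \<open>The window starting at \<open>b\<close> supplies a link, and the first link comes no
  later than that one.\<close>

lemma clique_first_link:
  assumes C: "clique (X, b, e)" and uv: "u \<in> X" "v \<in> X" "u \<noteq> v"
  shows "linked L (first_link L b u v) u v" "b \<le> first_link L b u v"
    "first_link L b u v \<le> b + \<Delta>" "first_link L b u v \<le> e"
proof -
  obtain t where t: "b \<le> t" "t \<le> b + \<Delta>" "t \<le> e" "linked L t u v"
    using delta_cliqueD[OF C uv, of b] by auto
  from first_link_props[OF t(4,1)] first_link_le[OF t(4,1)] t
  show "linked L (first_link L b u v) u v" "b \<le> first_link L b u v"
    "first_link L b u v \<le> b + \<Delta>" "first_link L b u v \<le> e" by auto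
qed

text \<open>The last admissible window starts at \<open>max (e - \<Delta>) b\<close>, which is the
  source of both lower bounds.\<close>

lemma clique_last_link:
  assumes C: "clique (X, b, e)" and uv: "u \<in> X" "v \<in> X" "u \<noteq> v"
  shows "linked L (last_link L e u v) u v" "last_link L e u v \<le> e"
    "e - \<Delta> \<le> last_link L e u v" "b \<le> last_link L e u v"
proof -
  obtain t where t: "max (e - \<Delta>) b \<le> t" "t \<le> e" "linked L t u v"
    using delta_cliqueD[OF C uv, of "max (e - \<Delta>) b"] by auto
  from last_link_props[OF t(3,2)] last_link_ge[OF t(3,2)] t
  show "linked L (last_link L e u v) u v" "last_link L e u v \<le> e"
    "e - \<Delta> \<le> last_link L e u v" "b \<le> last_link L e u v" by auto
qed

lemma first_link_le_latest_first:
  assumes "clique (X, b, e)" "u \<in> X" "v \<in> X" "u \<noteq> v"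
  shows "first_link L b u v \<le> latest_first L X b"
  unfolding latest_first_def
  by (rule Max_ge[OF finite_pair_values[OF clique_finite[OF assms(1)]]]) (use assms in auto)

lemma earliest_last_le_last_link:
  assumes "clique (X, b, e)" "u \<in> X" "v \<in> X" "u \<noteq> v"
  shows "earliest_last L X e \<le> last_link L e u v"
  unfolding earliest_last_def
  by (rule Min_le[OF finite_pair_values[OF clique_finite[OF assms(1)]]]) (use assms in auto)

lemma latest_first_attained:
  assumes "clique (X, b, e)"
  obtains u v where "u \<in> X" "v \<in> X" "u \<noteq> v" "latest_first L X b = first_link L b u v"
proof -
  have "latest_first L X b \<in> {first_link L b u v | u v. u \<in> X \<and> v \<in> X \<and> u \<noteq> v}"
    unfolding latest_first_def
    by (rule Max_in[OF finite_pair_values[OF clique_finite[OF assms]]])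
      (use two_le_card_distinct[OF delta_clique_bounds(2)[OF assms]] in auto)
  then show thesis using that by auto
qed

lemma earliest_last_attained:
  assumes "clique (X, b, e)"
  obtains u v where "u \<in> X" "v \<in> X" "u \<noteq> v" "earliest_last L X e = last_link L e u v"
proof -
  have "earliest_last L X e \<in> {last_link L e u v | u v. u \<in> X \<and> v \<in> X \<and> u \<noteq> v}"
    unfolding earliest_last_def
    by (rule Min_in[OF finite_pair_values[OF clique_finite[OF assms]]])
      (use two_le_card_distinct[OF delta_clique_bounds(2)[OF assms]] in auto)
  then show thesis using that by auto
qed

lemma latest_first_bounds:
  assumes "clique (X, b, e)"
  shows "latest_first L X b \<in> times" "b \<le> latest_first L X b"
    "latest_first L X b \<le> b + \<Delta>" "latest_first L X b \<le> e"
proof -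
  obtain u v where uv: "u \<in> X" "v \<in> X" "u \<noteq> v" and eq: "latest_first L X b = first_link L b u v"
    using latest_first_attained[OF assms] .
  from clique_first_link[OF assms uv]
  show "latest_first L X b \<in> times" "b \<le> latest_first L X b"
    "latest_first L X b \<le> b + \<Delta>" "latest_first L X b \<le> e"
    unfolding eq by (auto intro: linked_in_times)
qed

lemma earliest_last_bounds:
  assumes "clique (X, b, e)"
  shows "earliest_last L X e \<in> times" "earliest_last L X e \<le> e"
    "e - \<Delta> \<le> earliest_last L X e" "b \<le> earliest_last L X e"
proof -
  obtain u v where uv: "u \<in> X" "v \<in> X" "u \<noteq> v" and eq: "earliest_last L X e = last_link L e u v"
    using earliest_last_attained[OF assms] .
  from clique_last_link[OF assms uv]
  show "earliest_last L X e \<in> times" "earliest_last L X e \<le> e"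
    "e - \<Delta> \<le> earliest_last L X e" "b \<le> earliest_last L X e"
    unfolding eq by (auto intro: linked_in_times)
qed

section \<open>Extensions preserve cliques and the finite universe\<close>

lemma clique_extend_left:
  assumes C: "clique (X, b, e)"
  shows "clique (X, latest_first L X b - \<Delta>, e)"
proof (rule delta_cliqueI)
  let ?f = "latest_first L X b"
  note f = latest_first_bounds[OF C] and C' = delta_clique_bounds[OF C]
  show "t_start L \<le> ?f - \<Delta>" using times_padded[OF f(1)] by simp
  show "?f - \<Delta> \<le> e" using f C' by linarith
  fix u v \<tau>
  assume uv: "u \<in> X" "v \<in> X" "u \<noteq> v" and \<tau>: "?f - \<Delta> \<le> \<tau>" "\<tau> \<le> max (e - \<Delta>) (?f - \<Delta>)"
  show "\<exists>t. \<tau> \<le> t \<and> t \<le> \<tau> + \<Delta> \<and> t \<le> e \<and> linked L t u v"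
  \<comment> \<open>Starts from \<open>b\<close> on were already admissible in the old clique. A
    start before \<open>b\<close> is at least \<open>?f - \<Delta>\<close>, so its window reaches
    \<open>?f\<close> and contains the first link of every pair after \<open>b\<close>.\<close>
  proof (cases "b \<le> \<tau>")
    case True
    moreover have "\<tau> \<le> max (e - \<Delta>) b" using \<tau> f by linarith
    ultimately show ?thesis using delta_cliqueD[OF C uv] by blast
  next
    case False
    with clique_first_link[OF C uv] first_link_le_latest_first[OF C uv] \<tau> show ?thesis
      by (intro exI[of _ "first_link L b u v"]) auto
  qed
qed (use delta_clique_bounds[OF C] in auto)

lemma clique_extend_right:
  assumes C: "clique (X, b, e)"
  shows "clique (X, b, earliest_last L X e + \<Delta>)"
proof (rule delta_cliqueI)
  let ?l = "earliest_last L X e"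
  note l = earliest_last_bounds[OF C] and C' = delta_clique_bounds[OF C]
  show "?l + \<Delta> \<le> t_stop L" using times_padded[OF l(1)] by simp
  show "b \<le> ?l + \<Delta>" using l C' by linarith
  fix u v \<tau>
  assume uv: "u \<in> X" "v \<in> X" "u \<noteq> v" and \<tau>: "b \<le> \<tau>" "\<tau> \<le> max (?l + \<Delta> - \<Delta>) b"
  show "\<exists>t. \<tau> \<le> t \<and> t \<le> \<tau> + \<Delta> \<and> t \<le> ?l + \<Delta> \<and> linked L t u v"
  \<comment> \<open>A start that is new lies after \<open>e - \<Delta>\<close> and not after
    \<open>?l\<close>, so its window contains the last link of every pair before
    \<open>e\<close>.\<close>
  proof (cases "\<tau> \<le> max (e - \<Delta>) b")
    case True
    with delta_cliqueD[OF C uv \<tau>(1)] obtain t where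
      "\<tau> \<le> t" "t \<le> \<tau> + \<Delta>" "t \<le> e" "linked L t u v" by blast
    with l show ?thesis by (intro exI[of _ t]) auto
  next
    case False
    with clique_last_link[OF C uv] earliest_last_le_last_link[OF C uv] \<tau> l show ?thesis
      by (intro exI[of _ "last_link L e u v"]) auto
  qed
qed (use delta_clique_bounds[OF C] in auto)

lemma extension_cases:
  assumes "D \<in> extensions L \<Delta> (X, b, e)"
  obtains v where "v \<in> nodes L - X" "clique (X \<union> {v}, b, e)" "D = (X \<union> {v}, b, e)"
    | "D = (X, latest_first L X b - \<Delta>, e)"
    | "D = (X, b, earliest_last L X e + \<Delta>)"
  using assms unfolding extensions_def node_extensions_def left_extension_eq right_extension_eq
  by (auto split: if_splits)

lemma clique_extensions:
  assumes "clique C" "D \<in> extensions L \<Delta> C"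
  shows "clique D"
proof (cases C)
  case (fields X b e)
  with assms have C: "clique (X, b, e)" and D: "D \<in> extensions L \<Delta> (X, b, e)" by simp_all
  from D show ?thesis
    by (rule extension_cases) (simp_all add: clique_extend_left[OF C] clique_extend_right[OF C])
qed

lemma universe_extensions:
  assumes "clique C" "C \<in> universe" "D \<in> extensions L \<Delta> C"
  shows "D \<in> universe"
proof (cases C)
  case (fields X b e)
  with assms have C: "clique (X, b, e)" "(X, b, e) \<in> universe"
    and D: "D \<in> extensions L \<Delta> (X, b, e)" by simp_all
  from D show ?thesis
    by (rule extension_cases)
      (use C(2) latest_first_bounds(1)[OF C(1)] earliest_last_bounds(1)[OF C(1)] in
        \<open>auto simp: universe_def\<close>)
qed

section \<open>Maximality as absence of extensions\<close>

lemma left_end_maximal: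
  assumes C: "clique (X, b, e)" and C': "clique (X, b', e')"
    and le: "b' \<le> b" "e \<le> e'" and b: "b = latest_first L X b - \<Delta>"
  shows "b' = b"
proof (rule ccontr)
  assume "b' \<noteq> b"
  with le have "b' < b" by simp
  obtain u v where uv: "u \<in> X" "v \<in> X" "u \<noteq> v" "latest_first L X b = first_link L b u v"
    using latest_first_attained[OF C] .
  obtain c where c: "c < b" "\<And>t. t \<in> times \<Longrightarrow> t < b \<Longrightarrow> t < c"
    using finite_gap_below[OF finite_times, of b] by blast
  \<comment> \<open>This start lies in \<open>[c, b)\<close>: its window ends before
    \<open>b + \<Delta>\<close>, the first link of \<open>u\<close> and \<open>v\<close> after
    \<open>b\<close>, and \<open>c\<close> exceeds every link time before \<open>b\<close>. The
    maximum with \<open>b'\<close> keeps it admissible for the larger clique.\<close>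
  let ?\<tau> = "max b' c"
  have "?\<tau> \<le> max (e' - \<Delta>) b'"
    using \<open>b' < b\<close> c(1) le b latest_first_bounds[OF C] by linarith
  then obtain t where t: "?\<tau> \<le> t" "t \<le> ?\<tau> + \<Delta>" "linked L t u v"
    using delta_cliqueD[OF C' uv(1-3), of ?\<tau>] by auto
  have "t < b"
    using first_link_le[OF t(3), of b] t(2) \<open>b' < b\<close> c(1) b uv(4) by linarith
  with c(2)[OF linked_in_times[OF t(3)]] t(1) show False by linarith
qed

lemma right_end_maximal:
  assumes C: "clique (X, b, e)" and C': "clique (X, b', e')"
    and le: "b' \<le> b" "e \<le> e'" and e: "e = earliest_last L X e + \<Delta>"
  shows "e' = e"
proof (rule ccontr)
  assume "e' \<noteq> e"
  with le have "e < e'" by simp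
  obtain u v where uv: "u \<in> X" "v \<in> X" "u \<noteq> v" "earliest_last L X e = last_link L e u v"
    using earliest_last_attained[OF C] .
  obtain c where c: "e < c" "\<And>t. t \<in> times \<Longrightarrow> e < t \<Longrightarrow> c < t"
    using finite_gap_above[OF finite_times, of e] by blast
  \<comment> \<open>The window is chosen by its end, which lies in \<open>(e, c]\<close>; its start
    is then later than \<open>e - \<Delta>\<close>, the last link of \<open>u\<close> and
    \<open>v\<close> before \<open>e\<close>.\<close>
  let ?\<tau> = "min e' c - \<Delta>"
  have "b' \<le> ?\<tau>"
    using \<open>e < e'\<close> c(1) le e earliest_last_bounds[OF C] by linarith
  then obtain t where t: "?\<tau> \<le> t" "t \<le> ?\<tau> + \<Delta>" "linked L t u v"
    using delta_cliqueD[OF C' uv(1-3), of ?\<tau>] by auto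
  have "e < t"
    using last_link_ge[OF t(3), of e] t(1) \<open>e < e'\<close> c(1) e uv(4) by linarith
  with c(2)[OF linked_in_times[OF t(3)]] t(2) show False by linarith
qed

text \<open>Extensions are cliques that contain \<open>C\<close> and differ from it, so a maximal
  clique has none. Conversely, larger node sets are excluded first, because the two lemmas on end
  points compare cliques on the same \<open>X\<close>.\<close>

lemma maximal_iff_no_extensions:
  "maximal_delta_clique L \<Delta> C \<longleftrightarrow> clique C \<and> extensions L \<Delta> C = {}"
proof (cases C)
  case [simp]: (fields X b e)
  show ?thesis
  proof (intro iffI conjI)
    assume max: "maximal_delta_clique L \<Delta> C"
    then show C: "clique C" by (simp add: maximal_delta_clique_def)
    have *: "(X', b', e') = (X, b, e)"
      if "clique (X', b', e')" "X \<subseteq> X'" "b' \<le> b" "e \<le> e'" for X' b' e'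
      using max that unfolding maximal_delta_clique_def by auto
    have "node_extensions L \<Delta> C = {}"
      using * by (fastforce simp: node_extensions_def)
    moreover have "left_extension L \<Delta> C = {}"
      using *[OF clique_extend_left] latest_first_bounds(3)[of X b e] C
      by (fastforce simp: left_extension_eq)
    moreover have "right_extension L \<Delta> C = {}"
      using *[OF clique_extend_right] earliest_last_bounds(3)[of X b e] C
      by (fastforce simp: right_extension_eq)
    ultimately show "extensions L \<Delta> C = {}" by (simp add: extensions_def)
  next
    assume asm: "clique C \<and> extensions L \<Delta> C = {}"
    then have C: "clique (X, b, e)" by simp
    have node: "\<not> clique (X \<union> {v}, b, e)" if "v \<in> nodes L - X" for v
      using asm that by (auto simp: extensions_def node_extensions_def)
    have b: "b = latest_first L X b - \<Delta>" and e: "e = earliest_last L X e + \<Delta>"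
      using asm by (auto simp: extensions_def left_extension_eq right_extension_eq split: if_splits)
    have "(X', b', e') = (X, b, e)"
      if C': "clique (X', b', e')" and sub: "X \<subseteq> X'" "{b..e} \<subseteq> {b'..e'}" for X' b' e'
    proof -
      have le: "b' \<le> b" "e \<le> e'" using sub delta_clique_bounds[OF C] by auto
      have "X' = X"
      proof (rule ccontr)
        assume "X' \<noteq> X"
        with sub obtain v where v: "v \<in> X'" "v \<notin> X" by blast
        have "clique (X \<union> {v}, b, e)"
        proof (rule delta_clique_restrict[OF C' _ _ le])
          show "2 \<le> card (X \<union> {v})"
            using delta_clique_bounds(2)[OF C] clique_finite[OF C] v by simp
          \<comment> \<open>The latest first link \<open>b + \<Delta>\<close> occurs within the
            interval, which is therefore long enough for restricting the larger clique to
            it.\<close>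
          show "b + \<Delta> \<le> e" using b latest_first_bounds[OF C] by linarith
        qed (use v sub nonneg in auto)
        with node[of v] v delta_clique_bounds(1)[OF C'] show False by auto
      qed
      with left_end_maximal[OF C _ le b] right_end_maximal[OF C _ le e] C' show ?thesis by simp
    qed
    with C show "maximal_delta_clique L \<Delta> C"
      by (auto simp: maximal_delta_clique_def)
  qed
qed

section \<open>The loop invariant\<close>

definition alg_invariant :: "'v alg_state \<Rightarrow> bool" where
  "alg_invariant = (\<lambda>(S, R, M). S \<subseteq> M \<and> M \<subseteq> universe \<and> M \<subseteq> Collect clique \<and>
     fst (alg_init L) \<subseteq> M \<and> (\<forall>C\<in>M - S. extensions L \<Delta> C \<subseteq> M) \<and>
     R = {C \<in> M - S. extensions L \<Delta> C = {}})"

lemma clique_link: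
  assumes "(t, u, v) \<in> links L"
  shows "clique ({u, v}, t, t)"
proof (rule delta_cliqueI)
  have "u \<noteq> v" using assms link_stream by (auto simp: is_link_stream_def)
  then show "2 \<le> card {u, v}" by simp
  have "linked L t u v" using assms by (simp add: linked_def)
  then show "\<exists>s. \<tau> \<le> s \<and> s \<le> \<tau> + \<Delta> \<and> s \<le> t \<and> linked L s x y"
    if "x \<in> {u, v}" "y \<in> {u, v}" "x \<noteq> y" "t \<le> \<tau>" "\<tau> \<le> max (t - \<Delta>) t" for x y \<tau>
    using that nonneg linked_sym[of L t u v] by (intro exI[of _ t]) auto
qed (use assms link_stream in \<open>auto simp: is_link_stream_def\<close>)

lemma alg_invariant_init: "alg_invariant (alg_init L)"
proof -
  have "({u, v}, t, t) \<in> universe" if "(t, u, v) \<in> links L" for t u v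
    using delta_clique_bounds(1)[OF clique_link[OF that]] that
    by (force simp: universe_def times_def)
  then show ?thesis
    by (auto simp: alg_invariant_def alg_init_def Let_def clique_link)
qed

lemma alg_invariant_step:
  assumes "alg_step L \<Delta> s s'" "alg_invariant s"
  shows "alg_invariant s'"
proof -
  obtain S R M S' R' M' where s: "s = (S, R, M)" "s' = (S', R', M')"
    by (metis prod_cases3)
  obtain C where C: "C \<in> S"
    and eqs: "S' = S - {C} \<union> (extensions L \<Delta> C - M)" "M' = M \<union> extensions L \<Delta> C"
      "R' = (if extensions L \<Delta> C = {} then R \<union> {C} else R)"
    using assms(1) unfolding s by (rule alg_stepE)
  have inv: "S \<subseteq> M" "M \<subseteq> universe" "M \<subseteq> Collect clique"
    "fst (alg_init L) \<subseteq> M" "\<And>D. D \<in> M - S \<Longrightarrow> extensions L \<Delta> D \<subseteq> M"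
    "R = {C \<in> M - S. extensions L \<Delta> C = {}}"
    using assms(2) by (auto simp: alg_invariant_def s)
  \<comment> \<open>\<open>M - S\<close> consists of the processed candidates. Since
    \<open>C\<close> is in \<open>M\<close> and only candidates outside \<open>M\<close> enter
    \<open>S\<close>, \<open>C\<close> never returns to \<open>S\<close>.\<close>
  have processed: "M' - S' = insert C (M - S)" using C inv(1) by (auto simp: eqs)
  have "clique C" "C \<in> universe" using C inv by auto
  then have "M' \<subseteq> universe" "M' \<subseteq> Collect clique"
    using inv(2,3) clique_extensions[of C] universe_extensions[of C] unfolding eqs(2) by blast+
  moreover have "S' \<subseteq> M'" "fst (alg_init L) \<subseteq> M'"
    using inv by (auto simp: eqs)
  moreover have "\<forall>D\<in>M' - S'. extensions L \<Delta> D \<subseteq> M'"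
    unfolding processed using inv(5) by (auto simp: eqs(2))
  moreover have "R' = {C \<in> M' - S'. extensions L \<Delta> C = {}}"
    unfolding processed eqs(3) inv(6) by auto
  ultimately show ?thesis by (auto simp: alg_invariant_def s)
qed

lemma alg_invariant_reachable: "(alg_step L \<Delta>)\<^sup>*\<^sup>* (alg_init L) s \<Longrightarrow> alg_invariant s"
  by (induction rule: rtranclp_induct) (auto intro: alg_invariant_init alg_invariant_step)

section \<open>Termination and existence of a result\<close>

definition remaining :: "'v alg_state \<Rightarrow> nat" where
  "remaining = (\<lambda>(S, R, M). card (universe - (M - S)))"

text \<open>The measure counts undiscovered candidates together with those waiting in
  \<open>S\<close>. Discovering a candidate leaves it unchanged, and processing \<open>C\<close>
  lowers it.\<close>

lemma remaining_step:
  assumes "alg_step L \<Delta> s s'" "alg_invariant s"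
  shows "remaining s' < remaining s"
proof -
  obtain S R M S' R' M' where s: "s = (S, R, M)" "s' = (S', R', M')"
    by (metis prod_cases3)
  obtain C where C: "C \<in> S"
    and eqs: "S' = S - {C} \<union> (extensions L \<Delta> C - M)" "M' = M \<union> extensions L \<Delta> C"
    using assms(1) unfolding s by (rule alg_stepE)
  have inv: "S \<subseteq> M" "M \<subseteq> universe" using assms(2) by (auto simp: alg_invariant_def s)
  have "M' - S' = insert C (M - S)" using C inv(1) by (auto simp: eqs)
  then have "universe - (M' - S') \<subset> universe - (M - S)" using C inv by auto
  then show ?thesis
    using finite_universe by (auto simp: remaining_def s intro: psubset_card_mono)
qed

lemma terminates: "alg_terminates L \<Delta>"
  unfolding alg_terminates_def
proof
  assume "\<exists>\<sigma>. \<sigma> 0 = alg_init L \<and> (\<forall>i::nat. alg_step L \<Delta> (\<sigma> i) (\<sigma> (Suc i)))"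
  then obtain \<sigma> where \<sigma>: "\<sigma> 0 = alg_init L" "\<And>i::nat. alg_step L \<Delta> (\<sigma> i) (\<sigma> (Suc i))" by blast
  have inv: "alg_invariant (\<sigma> i)" for i
    by (induction i) (auto simp: \<sigma>(1) intro: alg_invariant_init alg_invariant_step \<sigma>(2))
  have "remaining (\<sigma> i) + i \<le> remaining (\<sigma> 0)" for i
  proof (induction i)
    case (Suc i)
    with remaining_step[OF \<sigma>(2)[of i] inv[of i]] show ?case by linarith
  qed simp
  from this[of "Suc (remaining (\<sigma> 0))"] show False by simp
qed

text \<open>Gives the converse half of the final equivalence: once every result is known to be the
  set of maximal cliques, some run must actually return that set.\<close>

lemma returns_some: "\<exists>R. alg_returns L \<Delta> R"
proof -
  have "\<exists>R M. (alg_step L \<Delta>)\<^sup>*\<^sup>* s ({}, R, M)" if "alg_invariant s" for s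
    using that
  proof (induction "remaining s" arbitrary: s rule: less_induct)
    case less
    obtain S R M where s: "s = (S, R, M)" by (metis prod_cases3)
    show ?case
    proof (cases "S = {}")
      case True
      then show ?thesis using s by blast
    next
      case False
      then obtain s' where step: "alg_step L \<Delta> s s'"
        using alg_step_exists s by (metis ex_in_conv)
      from less.hyps[OF remaining_step[OF step less.prems] alg_invariant_step[OF step less.prems]] step
      show ?thesis by (meson converse_rtranclp_into_rtranclp)
    qed
  qed
  from this[OF alg_invariant_init] show ?thesis by (simp add: alg_returns_def)
qed

section \<open>Completeness: reaching every maximal clique\<close>

text \<open>Formulated for an arbitrary finite closed set of cliques, so that the order in which
  candidates are processed does not enter the argument.\<close>

lemma maximal_in_closed:
  assumes cl: "M \<subseteq> Collect clique" "fst (alg_init L) \<subseteq> M" "\<And>C. C \<in> M \<Longrightarrow> extensions L \<Delta> C \<subseteq> M"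
    and "finite M" and max: "maximal_delta_clique L \<Delta> C"
  shows "C \<in> M"
proof (cases C)
  case [simp]: (fields X b e)
  from max have C: "clique (X, b, e)" and ext: "extensions L \<Delta> (X, b, e) = {}"
    by (auto simp: maximal_iff_no_extensions)
  have b: "b = latest_first L X b - \<Delta>" and e: "e = earliest_last L X e + \<Delta>"
    using ext by (auto simp: extensions_def left_extension_eq right_extension_eq split: if_splits)
  define f where "f = b + \<Delta>"
  obtain u v where uv: "u \<in> X" "v \<in> X" "u \<noteq> v" and f: "first_link L b u v = f"
    using latest_first_attained[OF C] b f_def by (metis add.commute diff_add_cancel)
  have "f \<le> e" and link: "linked L f u v" using clique_first_link[OF C uv] f by auto
  \<comment> \<open>Every right end from \<open>f = b + \<Delta>\<close> on leaves an interval of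
    length at least \<open>\<Delta>\<close>, so subcliques of \<open>C\<close> survive
    restriction.\<close>
  have restrict: "clique (Y, b, e')" if "Y \<subseteq> X" "u \<in> Y" "v \<in> Y" "f \<le> e'" "e' \<le> e" for Y e'
  proof (rule delta_clique_restrict[OF C that(1)])
    have "card {u, v} \<le> card Y"
      using that finite_subset[OF that(1) clique_finite[OF C]] by (intro card_mono) auto
    then show "2 \<le> card Y" using uv by simp
  qed (use that nonneg f_def in auto)
  have start: "({u, v}, f, f) \<in> M"
    using link cl(2) by (fastforce simp: linked_def alg_init_def Let_def insert_commute)
  have "first_link L f u v = f"
    using first_link_le[OF link] first_link_props[OF link] by fastforce
  then have "latest_first L {u, v} f = f"
    using latest_first_attained[of "{u, v}" f f] start cl(1) first_link_sym[of L f u v]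
    by (metis insertE singletonD subsetD mem_Collect_eq)
  \<comment> \<open>For \<open>\<Delta> = 0\<close> there is no left extension, but then
    \<open>b = f\<close> and the initial candidate is already the required one.\<close>
  then have "({u, v}, b, f) \<in> M"
    using start cl(3)[OF start] by (auto simp: extensions_def left_extension_eq f_def split: if_splits)
  \<comment> \<open>Nodes of \<open>X\<close> are added one at a time over the fixed interval; each
    intermediate candidate is a clique by \<open>restrict\<close>, so it is a node extension of its
    predecessor.\<close>
  moreover have "({u, v} \<union> Z, b, f) \<in> M" if "finite Z" "Z \<subseteq> X" for Z
    using that
  proof (induction Z rule: finite_induct)
    case empty
    then show ?case using calculation by simp
  next
    case (insert w Z)
    let ?Y = "{u, v} \<union> Z"
    have Y: "(?Y, b, f) \<in> M" using insert by simp
    show ?case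
    proof (cases "w \<in> ?Y")
      case True
      then have "{u, v} \<union> insert w Z = ?Y" by auto
      with Y show ?thesis by simp
    next
      case False
      have "clique (?Y \<union> {w}, b, f)"
        using insert.prems uv \<open>f \<le> e\<close> by (intro restrict) auto
      then have "(?Y \<union> {w}, b, f) \<in> extensions L \<Delta> (?Y, b, f)"
        using False insert.prems delta_clique_bounds(1)[OF C]
        unfolding extensions_def node_extensions_def by auto
      then have "(?Y \<union> {w}, b, f) \<in> M" using cl(3)[OF Y] by blast
      then show ?thesis by (simp add: insert_commute)
    qed
  qed
  from this[OF clique_finite[OF C] subset_refl] have Xf: "(X, b, f) \<in> M"
    using uv by (simp add: insert_absorb)
  \<comment> \<open>The right ends reached in \<open>M\<close> without passing \<open>e\<close>; the
    largest one, \<open>m\<close>, turns out to be \<open>e\<close>.\<close>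
  let ?E = "{e'. (X, b, e') \<in> M \<and> e' \<le> e}"
  have "finite ?E"
    by (rule finite_subset[of _ "(snd \<circ> snd) ` M"]) (use \<open>finite M\<close> in force)+
  have "f \<in> ?E" using Xf \<open>f \<le> e\<close> by simp
  define m where "m = Max ?E"
  have m: "(X, b, m) \<in> M" "m \<le> e" and m_max: "\<And>e'. e' \<in> ?E \<Longrightarrow> e' \<le> m"
    using Max_in[OF \<open>finite ?E\<close>] Max_ge[OF \<open>finite ?E\<close>] \<open>f \<in> ?E\<close> by (auto simp: m_def)
  have Cm: "clique (X, b, m)" using m(1) cl(1) by blast
  \<comment> \<open>Last links are monotone in the right end, so extending from \<open>m\<close>
    cannot pass \<open>earliest_last L X e + \<Delta> = e\<close>.\<close>
  have "earliest_last L X m \<le> earliest_last L X e"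
  proof -
    obtain x y where xy: "x \<in> X" "y \<in> X" "x \<noteq> y" "earliest_last L X e = last_link L e x y"
      using earliest_last_attained[OF C] .
    have "earliest_last L X m \<le> last_link L m x y"
      using earliest_last_le_last_link[OF Cm xy(1-3)] .
    also have "\<dots> \<le> last_link L e x y"
      using clique_last_link[OF Cm xy(1-3)] m(2) by (intro last_link_ge) auto
    finally show ?thesis using xy(4) by simp
  qed
  then have le_e: "earliest_last L X m + \<Delta> \<le> e" using e by linarith
  have "m = earliest_last L X m + \<Delta>"
  proof (rule ccontr)
    assume neq: "m \<noteq> earliest_last L X m + \<Delta>"
    then have "(X, b, earliest_last L X m + \<Delta>) \<in> M"
      using cl(3)[OF m(1)] by (simp add: extensions_def right_extension_eq)
    with m_max le_e have "earliest_last L X m + \<Delta> \<le> m" by simp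
    with neq earliest_last_bounds[OF Cm] show False by linarith
  qed
  \<comment> \<open>The right end \<open>m\<close> is stuck, so no clique on \<open>X\<close>
    containing \<open>[b, m]\<close> ends later; applied to \<open>C\<close> itself this yields
    \<open>e = m\<close>.\<close>
  from right_end_maximal[OF Cm C order_refl m(2) this] m(1) show ?thesis by simp
qed

lemma returns_maximal_cliques:
  assumes "alg_returns L \<Delta> R"
  shows "R = {C. maximal_delta_clique L \<Delta> C}"
proof -
  \<comment> \<open>With \<open>S\<close> empty all of \<open>M\<close> is processed, so
    \<open>M\<close> is closed under extensions and \<open>R\<close> collects all its non-extendable
    elements.\<close>
  obtain M where "alg_invariant ({}, R, M)"
    using assms alg_invariant_reachable by (auto simp: alg_returns_def)
  then have M: "M \<subseteq> universe" "M \<subseteq> Collect clique" "fst (alg_init L) \<subseteq> M"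
    "\<And>C. C \<in> M \<Longrightarrow> extensions L \<Delta> C \<subseteq> M" and R: "R = {C \<in> M. extensions L \<Delta> C = {}}"
    by (auto simp: alg_invariant_def)
  have "C \<in> M" if "maximal_delta_clique L \<Delta> C" for C
    using maximal_in_closed[OF M(2-4) finite_subset[OF M(1) finite_universe] that] .
  then show ?thesis using M(2) by (auto simp: R maximal_iff_no_extensions)
qed

end

theorem theorem1:
  fixes L :: "'v link_stream" and \<Delta> :: real
  assumes "is_link_stream L"
    and "0 \<le> \<Delta>"
    and "\<forall>(t, u, v)\<in>links L. t_start L \<le> t - \<Delta> \<and> t + \<Delta> \<le> t_stop L"
  shows "alg_terminates L \<Delta> \<and>
    (\<forall>R. alg_returns L \<Delta> R \<longleftrightarrow> R = {C. maximal_delta_clique L \<Delta> C})"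
proof -
  interpret padded_link_stream L \<Delta> by unfold_locales (use assms in auto)
  show ?thesis using terminates returns_some returns_maximal_cliques by metis
qed

end
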